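(* Let $x_L<x_R$, let $a>0$ be a constant, and let $\kappa=\kappa(x,t)>0$ be a smooth function on $[x_L,x_R]\times[0,\infty)$. Consider the linear advection-diffusion initial-boundary-value problem $$\partial_t u+a\,\partial_x u=\partial_x(\kappa\,\partial_x u),\quad x\in(x_L,x_R),\ t>0,\qquad u(x,0)=f(x),$$ $$a\,u(x_L,t)-\kappa\,\partial_x u(x_L,t)=g_{x_L}(t),\qquad \kappa\,\partial_x u(x_R,t)=g_{x_R}(t),$$ with continuous boundary data $g_{x_L},g_{x_R}$. Let $\mathcal F\subset C^1([x_L,x_R])$ be a finite-dimensional function space. Let $D=P^{-1}Q$ be a diagonal-norm $\mathcal F$-based summation-by-parts (FSBP) operator on grid points $x_L=y_0<y_1<\dots<y_N=x_R$ with grid size $h$. Consider the semi-discretization for $\mathbf u(t)=[u_0(t),\dots,u_N(t)]^T$, $$\mathbf u_t+a\,D\mathbf u=D(\mathcal K D\mathbf u)+P^{-1}\mathbb S,\qquad \mathbf u(0)=\mathbf f^h,$$ where $\mathcal K=\mathcal K(t)=\operatorname{diag}(\kappa(y_0,t),\dots,\kappa(y_N,t))$ and $\mathbb S=[\mathbb S_0,0,\dots,0,\mathbb S_1]^T$ with $$\mathbb S_0=\sigma_0\big(a u_0-(\mathcal K D\mathbf u)_0-g_{x_L}\big),\qquad \mathbb S_1=-\sigma_1\big((\mathcal K D\mathbf u)_N-g_{x_R}\big).$$ Then, with $\sigma_0=-1$ and $\sigma_1=1$, the scheme is strongly (energy) stable with respect to the discrete norm $\|\mathbf v\|_h=(\mathbf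 v^TP\mathbf v)^{1/2}$.
   Context: FSBP operator: Let $\mathcal F\subset C^1([x_L,x_R])$ be a finite-dimensional function space and let $y_0=x_L<\dots<y_N=x_R$ be grid points. For a function $v$, write $v(\mathbf y)=[v(y_0),\dots,v(y_N)]^T$. A matrix $D=P^{-1}Q\in\mathbb R^{(N+1)\times(N+1)}$ is an $\mathcal F$-based summation-by-parts (FSBP) operator if (i) $D\,v(\mathbf y)=v'(\mathbf y)$ for all $v\in\mathcal F$; (ii) $P$ is symmetric positive definite; (iii) $Q+Q^T=B:=\operatorname{diag}(-1,0,\dots,0,1)$. It is diagonal-norm if $P$ is diagonal. Components: $u_0$ and $u_N$ (and $(\cdot)_0$, $(\cdot)_N$) are the components of a grid vector at $y_0=x_L$ and $y_N=x_R$. The vector $\mathbf f^h$ is the discrete initial data (a projection of $f$ to the grid). Stability notions: The grid parameter is $h$ (maximal distance of neighbouring points), and the discretization is considered for all sufficiently small $h$ (i.e. for a family of grids and FSBP operators indexed by $h$). The scheme is stable if, for zero boundary data $g_{x_L}=g_{x_R}=0$ and initial data $\mathbf f^h$ vanishing at the boundary points, the solution satisfies $\|\mathbf u(t)\|_h\le C e^{\alpha_d t}\|\mathbf f^h\|_h$ for all $t\ge0$ and all sufficiently small $h$, with constants $C,\alpha_d$ independent of $\mathbf f^h$ and $h$. The scheme is strongly (energy) stable if it is stable and, for general data, $$\|\mathbf u(t)\|_h^2\le C(t)\Big(\|\mathbf f^h\|_h^2+\max_{\tau\in[0,t]}|g_{x_L}(\tau)|^2+\max_{\tau\in[0,t]}|g_{x_R}(\tau)|^2\Big)$$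 for all $t\ge 0$ and all sufficiently small $h$, where $C(t)$ is bounded for finite $t$ and independent of $\mathbf f^h,g_{x_L},g_{x_R}$ and $h$. (There is no forcing term in this problem.) *)

theory Defs
  imports
    "HOL-Analysis.Derivative"
    "HOL-Library.Function_Algebras"
    "Jordan_Normal_Form.Gauss_Jordan_Elimination"
begin

subsection \<open>Smooth functions and function spaces\<close>

text \<open>
  \<open>k\<close> times continuously differentiable on a set that need not be open: derivatives are taken
  within the set. On an interval or a box of nonempty interior they are unique, and at the
  boundary they are the one-sided ones.
\<close>
primrec Ck_on :: "nat \<Rightarrow> 'a::real_normed_vector set \<Rightarrow> ('a \<Rightarrow> real) \<Rightarrow> bool" where
  "Ck_on 0 S f \<longleftrightarrow> continuous_on S f"
| "Ck_on (Suc k) S f \<longleftrightarrow>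
     (\<exists>f'. (\<forall>x\<in>S. (f has_derivative f' x) (at x within S)) \<and> (\<forall>v. Ck_on k S (\<lambda>x. f' x v)))"

definition smooth_on :: "'a::real_normed_vector set \<Rightarrow> ('a \<Rightarrow> real) \<Rightarrow> bool" where
  "smooth_on S f \<longleftrightarrow> (\<forall>k. Ck_on k S f)"

global_interpretation fun_space: vector_space "\<lambda>(c::real) (f::real \<Rightarrow> real) x. c * f x"
  by unfold_locales (auto simp: fun_eq_iff algebra_simps)

text \<open>
  Functions on \<open>{xL..xR}\<close> are represented by total functions; their values outside the
  interval are never used.
\<close>
definition C1_function_space :: "real \<Rightarrow> real \<Rightarrow> (real \<Rightarrow> real) set \<Rightarrow> bool" where
  "C1_function_space xL xR F \<longleftrightarrow>
     fun_space.subspace F \<and>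
     (\<exists>B. finite B \<and> fun_space.span B = F) \<and>
     (\<forall>v\<in>F. Ck_on 1 {xL..xR} v)"

subsection \<open>FSBP operators\<close>

text \<open>Grid points \<open>node d 0, \<dots>, node d (Nn d)\<close>; vectors and matrices have size \<open>Nn d + 1\<close>.\<close>
record fsbp =
  Nn :: nat
  node :: "nat \<Rightarrow> real"
  Pmat :: "real mat"
  Qmat :: "real mat"

definition grid_vec :: "fsbp \<Rightarrow> (real \<Rightarrow> real) \<Rightarrow> real vec" where
  "grid_vec d v = vec (Nn d + 1) (\<lambda>i. v (node d i))"

definition grid_size :: "fsbp \<Rightarrow> real" where
  "grid_size d = Max ((\<lambda>i. node d (i + 1) - node d i) ` {..<Nn d})"

definition Pinv :: "fsbp \<Rightarrow> real mat" where
  "Pinv d = the (mat_inverse (Pmat d))"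

definition Dmat :: "fsbp \<Rightarrow> real mat" where
  "Dmat d = Pinv d * Qmat d"

definition Bmat :: "fsbp \<Rightarrow> real mat" where
  "Bmat d = mat_diag (Nn d + 1) (\<lambda>i. if i = 0 then - 1 else if i = Nn d then 1 else 0)"

definition sym_pos_def :: "nat \<Rightarrow> real mat \<Rightarrow> bool" where
  "sym_pos_def n A \<longleftrightarrow>
     A \<in> carrier_mat n n \<and> transpose_mat A = A \<and>
     (\<forall>v\<in>carrier_vec n. v \<noteq> 0\<^sub>v n \<longrightarrow> scalar_prod v (A *\<^sub>v v) > 0)"

definition is_fsbp :: "real \<Rightarrow> real \<Rightarrow> (real \<Rightarrow> real) set \<Rightarrow> fsbp \<Rightarrow> bool" where
  "is_fsbp xL xR F d \<longleftrightarrow>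
     node d 0 = xL \<and> node d (Nn d) = xR \<and> (\<forall>i<Nn d. node d i < node d (i + 1)) \<and>
     Qmat d \<in> carrier_mat (Nn d + 1) (Nn d + 1) \<and>
     (\<forall>v\<in>F. Dmat d *\<^sub>v grid_vec d v
            = grid_vec d (\<lambda>x. vector_derivative v (at x within {xL..xR}))) \<and>
     sym_pos_def (Nn d + 1) (Pmat d) \<and>
     Qmat d + transpose_mat (Qmat d) = Bmat d"

definition diagonal_norm_fsbp :: "real \<Rightarrow> real \<Rightarrow> (real \<Rightarrow> real) set \<Rightarrow> fsbp \<Rightarrow> bool" where
  "diagonal_norm_fsbp xL xR F d \<longleftrightarrow> is_fsbp xL xR F d \<and> diagonal_mat (Pmat d)"

definition norm_h :: "fsbp \<Rightarrow> real vec \<Rightarrow> real" where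
  "norm_h d v = sqrt (scalar_prod v (Pmat d *\<^sub>v v))"

subsection \<open>The semi-discretization\<close>

definition Kmat :: "(real \<Rightarrow> real \<Rightarrow> real) \<Rightarrow> fsbp \<Rightarrow> real \<Rightarrow> real mat" where
  "Kmat \<kappa> d t = mat_diag (Nn d + 1) (\<lambda>i. \<kappa> (node d i) t)"

definition sat_vec ::
  "real \<Rightarrow> (real \<Rightarrow> real \<Rightarrow> real) \<Rightarrow> real \<Rightarrow> real \<Rightarrow> (real \<Rightarrow> real) \<Rightarrow> (real \<Rightarrow> real)
     \<Rightarrow> fsbp \<Rightarrow> real \<Rightarrow> real vec \<Rightarrow> real vec" where
  "sat_vec a \<kappa> \<sigma>0 \<sigma>1 gL gR d t v =
     (let w = Kmat \<kappa> d t *\<^sub>v (Dmat d *\<^sub>v v);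
          S0 = \<sigma>0 * (a * vec_index v 0 - vec_index w 0 - gL t);
          S1 = - \<sigma>1 * (vec_index w (Nn d) - gR t)
      in vec (Nn d + 1) (\<lambda>i. if i = 0 then S0 else if i = Nn d then S1 else 0))"

text \<open>
  \<open>real vec\<close> carries no topology, so continuity and the time derivative are componentwise.
  The differential equation holds for \<open>t > 0\<close>, and \<open>u\<close> is continuous up to \<open>t = 0\<close>.
\<close>
definition scheme_solution ::
  "real \<Rightarrow> (real \<Rightarrow> real \<Rightarrow> real) \<Rightarrow> real \<Rightarrow> real \<Rightarrow> (real \<Rightarrow> real) \<Rightarrow> (real \<Rightarrow> real)
     \<Rightarrow> fsbp \<Rightarrow> real vec \<Rightarrow> (real \<Rightarrow> real vec) \<Rightarrow> bool" where
  "scheme_solution a \<kappa> \<sigma>0 \<sigma>1 gL gR d f u \<longleftrightarrow>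
     (\<forall>t\<ge>0. u t \<in> carrier_vec (Nn d + 1)) \<and>
     (\<forall>i\<le>Nn d. continuous_on {0..} (\<lambda>t. vec_index (u t) i)) \<and>
     u 0 = f \<and>
     (\<forall>t>0. \<exists>ut\<in>carrier_vec (Nn d + 1).
        (\<forall>i\<le>Nn d. ((\<lambda>s. vec_index (u s) i) has_real_derivative vec_index ut i) (at t)) \<and>
        ut + a \<cdot>\<^sub>v (Dmat d *\<^sub>v u t)
          = Dmat d *\<^sub>v (Kmat \<kappa> d t *\<^sub>v (Dmat d *\<^sub>v u t))
            + Pinv d *\<^sub>v sat_vec a \<kappa> \<sigma>0 \<sigma>1 gL gR d t (u t))"

subsection \<open>Stability\<close>

text \<open>
  A family of discretizations assigns an operator \<open>d h\<close> to each admissible grid size \<open>h \<in> H\<close>.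
\<close>
definition fsbp_family ::
  "real \<Rightarrow> real \<Rightarrow> (real \<Rightarrow> real) set \<Rightarrow> real set \<Rightarrow> (real \<Rightarrow> fsbp) \<Rightarrow> bool" where
  "fsbp_family xL xR F H d \<longleftrightarrow>
     (\<forall>h\<in>H. diagonal_norm_fsbp xL xR F (d h) \<and> grid_size (d h) = h)"

definition stable ::
  "real \<Rightarrow> (real \<Rightarrow> real \<Rightarrow> real) \<Rightarrow> real \<Rightarrow> real \<Rightarrow> real set \<Rightarrow> (real \<Rightarrow> fsbp) \<Rightarrow> bool" where
  "stable a \<kappa> \<sigma>0 \<sigma>1 H d \<longleftrightarrow>
     (\<exists>C \<alpha> h0. h0 > 0 \<and>
        (\<forall>h\<in>H. h \<le> h0 \<longrightarrow>
           (\<forall>f\<in>carrier_vec (Nn (d h) + 1). \<forall>u.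
              vec_index f 0 = 0 \<longrightarrow> vec_index f (Nn (d h)) = 0 \<longrightarrow>
              scheme_solution a \<kappa> \<sigma>0 \<sigma>1 (\<lambda>_. 0) (\<lambda>_. 0) (d h) f u \<longrightarrow>
              (\<forall>t\<ge>0. norm_h (d h) (u t) \<le> C * exp (\<alpha> * t) * norm_h (d h) f))))"

definition strongly_stable ::
  "real \<Rightarrow> (real \<Rightarrow> real \<Rightarrow> real) \<Rightarrow> real \<Rightarrow> real \<Rightarrow> real set \<Rightarrow> (real \<Rightarrow> fsbp) \<Rightarrow> bool" where
  "strongly_stable a \<kappa> \<sigma>0 \<sigma>1 H d \<longleftrightarrow>
     stable a \<kappa> \<sigma>0 \<sigma>1 H d \<and>
     (\<exists>(C :: real \<Rightarrow> real) h0. h0 > 0 \<and>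
        (\<forall>T\<ge>0. \<exists>M. \<forall>t\<in>{0..T}. \<bar>C t\<bar> \<le> M) \<and>
        (\<forall>h\<in>H. h \<le> h0 \<longrightarrow>
           (\<forall>f\<in>carrier_vec (Nn (d h) + 1). \<forall>gL gR u.
              continuous_on {0..} gL \<longrightarrow> continuous_on {0..} gR \<longrightarrow>
              scheme_solution a \<kappa> \<sigma>0 \<sigma>1 gL gR (d h) f u \<longrightarrow>
              (\<forall>t\<ge>0. (norm_h (d h) (u t))\<^sup>2
                 \<le> C t * ((norm_h (d h) f)\<^sup>2
                          + (SUP \<tau>\<in>{0..t}. \<bar>gL \<tau>\<bar>\<^sup>2) + (SUP \<tau>\<in>{0..t}. \<bar>gR \<tau>\<bar>\<^sup>2))))))"

end

theory Submission
  imports Defs "Jordan_Normal_Form.Determinant"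
begin

text \<open>
  Differentiate \<open>\<parallel>u\<parallel>\<^sub>h\<^sup>2\<close> along the scheme. By the summation-by-parts rule \<open>Q + Q\<^sup>T = B\<close> the
  advective and diffusive terms reduce to boundary terms plus the dissipation
  \<open>-2 (P D u) \<cdot> (K D u)\<close>, which is nonpositive because \<open>P\<close> and \<open>K\<close> are both diagonal. With
  \<open>\<sigma>\<^sub>0 = -1\<close> and \<open>\<sigma>\<^sub>1 = 1\<close> the penalties cancel all boundary fluxes and leave
  \<open>-a u\<^sub>0\<^sup>2 - a u\<^sub>N\<^sup>2 + 2 u\<^sub>0 g\<^sub>L + 2 u\<^sub>N g\<^sub>R \<le> (g\<^sub>L\<^sup>2 + g\<^sub>R\<^sup>2) / a\<close>, so
  \<open>\<parallel>u(t)\<parallel>\<^sub>h\<^sup>2 \<le> \<parallel>f\<parallel>\<^sub>h\<^sup>2 + (max g\<^sub>L\<^sup>2 + max g\<^sub>R\<^sup>2) t / a\<close> for every grid.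
\<close>

section \<open>Diagonal and positive definite matrices\<close>

lemma mat_diag_mult_vec:
  fixes v :: "'a::comm_semiring_1 vec"
  assumes "v \<in> carrier_vec n"
  shows "mat_diag n f *\<^sub>v v = vec n (\<lambda>i. f i * vec_index v i)"
proof (rule eq_vecI)
  fix i assume i: "i < dim_vec (vec n (\<lambda>i. f i * vec_index v i))"
  then have "vec_index (mat_diag n f *\<^sub>v v) i
      = (\<Sum>j\<in>{0..<n}. (if i = j then f j else 0) * vec_index v j)"
    using assms by (simp add: mat_diag_def scalar_prod_def)
  also have "\<dots> = (\<Sum>j\<in>{0..<n}. if i = j then f j * vec_index v j else 0)"
    by (rule sum.cong) auto
  finally show "vec_index (mat_diag n f *\<^sub>v v) i = vec_index (vec n (\<lambda>i. f i * vec_index v i)) i"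
    using i by simp
qed (simp add: mat_diag_def)

lemma diagonal_mat_eq_mat_diag:
  assumes "A \<in> carrier_mat n n" and "diagonal_mat A"
  shows "A = mat_diag n (\<lambda>i. A $$ (i, i))"
  using assms by (intro eq_matI) (auto simp: mat_diag_def diagonal_mat_def)

text \<open>A nonzero kernel vector would make the quadratic form vanish, so the determinant is
  nonzero. This gives meaning to the \<open>the\<close> in \<open>Pinv\<close>.\<close>

lemma sym_pos_def_mat_inverse:
  assumes "sym_pos_def n A"
  obtains B where "mat_inverse A = Some B" "A * B = 1\<^sub>m n" "B \<in> carrier_mat n n"
proof -
  have A: "A \<in> carrier_mat n n" using assms by (simp add: sym_pos_def_def)
  have "det A \<noteq> 0"
  proof
    assume "det A = 0"
    then obtain v where v: "v \<in> carrier_vec n" "v \<noteq> 0\<^sub>v n" "A *\<^sub>v v = 0\<^sub>v n"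
      using det_0_iff_vec_prod_zero[OF A] by blast
    then have "scalar_prod v (A *\<^sub>v v) = 0" by simp
    moreover have "scalar_prod v (A *\<^sub>v v) > 0"
      using assms v(1,2) unfolding sym_pos_def_def by blast
    ultimately show False by simp
  qed
  then have "A \<in> Units (ring_mat TYPE(real) n ())"
    by (rule det_non_zero_imp_unit[OF A])
  then obtain B where "mat_inverse A = Some B"
    using mat_inverse(1)[OF A, where b = "()"] by (cases "mat_inverse A") auto
  with mat_inverse(2)[OF A] that show thesis by blast
qed

lemma sym_pos_def_form_nonneg:
  assumes "sym_pos_def n A" and "v \<in> carrier_vec n"
  shows "scalar_prod v (A *\<^sub>v v) \<ge> 0"
proof (cases "v = 0\<^sub>v n")
  case True
  have "A \<in> carrier_mat n n" using assms by (simp add: sym_pos_def_def)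
  then have "A *\<^sub>v v \<in> carrier_vec n" using assms(2) by simp
  then show ?thesis using True by simp
next
  case False
  then have "scalar_prod v (A *\<^sub>v v) > 0"
    using assms unfolding sym_pos_def_def by blast
  then show ?thesis by simp
qed

text \<open>Test the form on a unit vector. For diagonal \<open>Pmat d\<close> these entries are the
  quadrature weights of the discrete norm.\<close>

lemma sym_pos_def_diag_pos:
  assumes "sym_pos_def n A" and "i < n"
  shows "A $$ (i, i) > 0"
proof -
  have A: "A \<in> carrier_mat n n" using assms by (simp add: sym_pos_def_def)
  have "vec_index (unit_vec n i :: real vec) i \<noteq> vec_index (0\<^sub>v n) i"
    using assms(2) by simp
  then have "scalar_prod (unit_vec n i) (A *\<^sub>v unit_vec n i) > 0"
    using assms unfolding sym_pos_def_def by (metis unit_vec_carrier)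
  then show ?thesis using A assms(2) by simp
qed

section \<open>Summation by parts on the grid\<close>

text \<open>Discrete integration by parts: moving \<open>Q\<close> to the other factor transposes
  it, and \<open>Bmat d\<close> keeps only the two end components. \<open>Nn d > 0\<close> keeps
  these apart; on a single node \<open>Bmat d\<close> would be the number -1 and the right-hand side
  0.\<close>

lemma sbp_rule:
  assumes Q: "Q \<in> carrier_mat (Nn d + 1) (Nn d + 1)"
    and sbp: "Q + transpose_mat Q = Bmat d"
    and N: "Nn d > 0"
    and u: "u \<in> carrier_vec (Nn d + 1)" and w: "w \<in> carrier_vec (Nn d + 1)"
  shows "scalar_prod u (Q *\<^sub>v w) + scalar_prod (Q *\<^sub>v u) w
    = vec_index u (Nn d) * vec_index w (Nn d) - vec_index u 0 * vec_index w 0"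
proof -
  let ?n = "Nn d + 1"
  let ?b = "\<lambda>i. if i = 0 then - 1 else if i = Nn d then 1 else (0::real)"
  have Qt: "transpose_mat Q \<in> carrier_mat ?n ?n" using Q by simp
  have "scalar_prod (Q *\<^sub>v u) w = scalar_prod u (transpose_mat Q *\<^sub>v w)"
    using transpose_vec_mult_scalar[OF Qt w u] by simp
  then have "scalar_prod u (Q *\<^sub>v w) + scalar_prod (Q *\<^sub>v u) w
      = scalar_prod u (Bmat d *\<^sub>v w)"
    unfolding sbp[symmetric] add_mult_distrib_mat_vec[OF Q Qt w]
    using scalar_prod_add_distrib[of u ?n "Q *\<^sub>v w" "transpose_mat Q *\<^sub>v w"] u Q Qt w by simp
  also have "Bmat d *\<^sub>v w = vec ?n (\<lambda>i. ?b i * vec_index w i)"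
    unfolding Bmat_def by (rule mat_diag_mult_vec[OF w])
  also have "scalar_prod u \<dots> = (\<Sum>i\<in>{0..Nn d}. vec_index u i * (?b i * vec_index w i))"
    by (simp add: scalar_prod_def atLeastLessThanSuc_atLeastAtMost)
  also have "\<dots> = (\<Sum>i\<in>{0, Nn d}. vec_index u i * (?b i * vec_index w i))"
    by (rule sum.mono_neutral_right) auto
  finally show ?thesis using N by simp
qed

lemma is_fsbp_Nn_pos:
  assumes "is_fsbp xL xR F d" and "xL < xR"
  shows "Nn d > 0"
  using assms by (cases "Nn d") (auto simp: is_fsbp_def)

text \<open>Carries the sign of \<kappa>, known on the interval, over to the entries of
  \<open>Kmat\<close>.\<close>

lemma is_fsbp_node_in:
  assumes "is_fsbp xL xR F d" and "i \<le> Nn d"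
  shows "node d i \<in> {xL..xR}"
proof -
  have mono: "node d k \<le> node d (Suc k)" if "k < Nn d" for k
    using assms(1) that by (auto simp: is_fsbp_def intro: less_imp_le)
  have "node d j \<le> node d k" if "j \<le> k" "k \<le> Nn d" for j k
    using that(1,2)
  proof (induction k rule: dec_induct)
    case (step k)
    then show ?case using mono[of k] by simp
  qed simp
  from this[of 0 i] this[of i "Nn d"] show ?thesis
    using assms by (simp add: is_fsbp_def)
qed

section \<open>Energy rate of the semi-discretization\<close>

text \<open>Completing the square; the boundary dissipation absorbs the product of solution and
  data, which is where the factor 1/a comes from.\<close>

lemma young_boundary:
  fixes a x g :: real
  assumes "a > 0"
  shows "2 * x * g - a * x\<^sup>2 \<le> g\<^sup>2 / a"
proof -
  have "0 \<le> (a * x - g)\<^sup>2 / a" using assms by simp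
  also have "\<dots> = a * x\<^sup>2 - 2 * x * g + g\<^sup>2 / a"
    using assms by (simp add: field_simps power2_eq_square)
  finally show ?thesis by simp
qed

text \<open>Purely algebraic at a fixed time: \<open>v\<close> stands for the solution and
  \<open>ut\<close> for its derivative, so by symmetry of \<open>Pmat d\<close> the left-hand side
  is the rate of the squared norm.\<close>

lemma energy_rate_le:
  assumes fsbp: "diagonal_norm_fsbp xL xR F d" and "xL < xR" and a: "a > 0"
    and \<kappa>: "\<forall>x\<in>{xL..xR}. \<kappa> x t \<ge> 0"
    and v: "v \<in> carrier_vec (Nn d + 1)" and ut: "ut \<in> carrier_vec (Nn d + 1)"
    and eq: "ut + a \<cdot>\<^sub>v (Dmat d *\<^sub>v v)
          = Dmat d *\<^sub>v (Kmat \<kappa> d t *\<^sub>v (Dmat d *\<^sub>v v))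
            + Pinv d *\<^sub>v sat_vec a \<kappa> (- 1) 1 gL gR d t v"
  shows "2 * scalar_prod v (Pmat d *\<^sub>v ut) \<le> ((gL t)\<^sup>2 + (gR t)\<^sup>2) / a"
proof -
  let ?n = "Nn d + 1" and ?P = "Pmat d" and ?Q = "Qmat d" and ?D = "Dmat d"
  have op: "is_fsbp xL xR F d" and diagP: "diagonal_mat ?P"
    using fsbp by (auto simp: diagonal_norm_fsbp_def)
  have Q: "?Q \<in> carrier_mat ?n ?n" and spd: "sym_pos_def ?n ?P"
    and sbp: "?Q + transpose_mat ?Q = Bmat d"
    using op by (auto simp: is_fsbp_def)
  have P: "?P \<in> carrier_mat ?n ?n" using spd by (simp add: sym_pos_def_def)
  have N: "Nn d > 0" using op \<open>xL < xR\<close> by (rule is_fsbp_Nn_pos)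
  obtain R where "mat_inverse ?P = Some R" and PR: "?P * R = 1\<^sub>m ?n" and R: "R \<in> carrier_mat ?n ?n"
    using spd by (rule sym_pos_def_mat_inverse)
  then have Pinv: "Pinv d = R" by (simp add: Pinv_def)
  have D: "?D \<in> carrier_mat ?n ?n" using R Q by (simp add: Dmat_def Pinv)
  have PD: "?P *\<^sub>v (?D *\<^sub>v x) = ?Q *\<^sub>v x" if "x \<in> carrier_vec ?n" for x
  proof -
    have "?P * ?D = ?Q"
      using assoc_mult_mat[OF P R Q] PR Q by (simp add: Dmat_def Pinv)
    then show ?thesis using assoc_mult_mat_vec[OF P D that] by simp
  qed
  \<comment> \<open>\<open>w\<close> is the discrete diffusive flux and \<open>s\<close> the vector
    of boundary penalties.\<close>
  define w where "w = Kmat \<kappa> d t *\<^sub>v (?D *\<^sub>v v)"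
  define s where "s = sat_vec a \<kappa> (- 1) 1 gL gR d t v"
  have Dv: "?D *\<^sub>v v \<in> carrier_vec ?n" using D v by simp
  have w_eq: "w = vec ?n (\<lambda>i. \<kappa> (node d i) t * vec_index (?D *\<^sub>v v) i)"
    unfolding w_def Kmat_def by (rule mat_diag_mult_vec[OF Dv])
  have w: "w \<in> carrier_vec ?n" by (simp add: w_eq)
  have s: "s \<in> carrier_vec ?n" by (simp add: s_def sat_vec_def Let_def)
  \<comment> \<open>Multiplying the scheme by \<open>?P\<close> turns each outer \<open>?D\<close>
    into \<open>?Q\<close> and frees \<open>s\<close> from the inverse; the inner product with
    \<open>v\<close> then gives the energy balance.\<close>
  have "?P *\<^sub>v (ut + a \<cdot>\<^sub>v (?D *\<^sub>v v)) = ?P *\<^sub>v (?D *\<^sub>v w + R *\<^sub>v s)"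
    using eq by (simp add: w_def s_def Pinv)
  moreover have "?P *\<^sub>v (ut + a \<cdot>\<^sub>v (?D *\<^sub>v v)) = ?P *\<^sub>v ut + a \<cdot>\<^sub>v (?Q *\<^sub>v v)"
    using mult_add_distrib_mat_vec[OF P ut, of "a \<cdot>\<^sub>v (?D *\<^sub>v v)"] mult_mat_vec[OF P Dv] Dv
      PD[OF v] by simp
  moreover have "?P *\<^sub>v (?D *\<^sub>v w + R *\<^sub>v s) = ?Q *\<^sub>v w + s"
    using mult_add_distrib_mat_vec[OF P, of "?D *\<^sub>v w" "R *\<^sub>v s"] D w R s PD[OF w]
      assoc_mult_mat_vec[OF P R s] by (simp add: PR)
  ultimately have "scalar_prod v (?P *\<^sub>v ut + a \<cdot>\<^sub>v (?Q *\<^sub>v v)) = scalar_prod v (?Q *\<^sub>v w + s)"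
    by simp
  then have rate: "scalar_prod v (?P *\<^sub>v ut) + a * scalar_prod v (?Q *\<^sub>v v)
      = scalar_prod v (?Q *\<^sub>v w) + scalar_prod v s"
    using scalar_prod_add_distrib[of v ?n "?P *\<^sub>v ut" "a \<cdot>\<^sub>v (?Q *\<^sub>v v)"]
      scalar_prod_add_distrib[of v ?n "?Q *\<^sub>v w" s] v ut P Q w s by simp
  have advection: "2 * scalar_prod v (?Q *\<^sub>v v) = (vec_index v (Nn d))\<^sup>2 - (vec_index v 0)\<^sup>2"
    using sbp_rule[OF Q sbp N v v] comm_scalar_prod[of v ?n "?Q *\<^sub>v v"] v Q
    by (simp add: power2_eq_square)
  \<comment> \<open>Summation by parts leaves minus the product of \<open>?Q *\<^sub>v v\<close> and
    \<open>w\<close>. Since \<open>?P\<close> is diagonal, this product is a sum of squares with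
    weights \<open>?P $$ (i, i) * \<kappa> (node d i) t\<close>; for a general norm matrix its sign
    would not be clear.\<close>
  have diffusion: "scalar_prod v (?Q *\<^sub>v w)
      \<le> vec_index v (Nn d) * vec_index w (Nn d) - vec_index v 0 * vec_index w 0"
  proof -
    have "?Q *\<^sub>v v = mat_diag ?n (\<lambda>i. ?P $$ (i, i)) *\<^sub>v (?D *\<^sub>v v)"
      using PD[OF v] diagonal_mat_eq_mat_diag[OF P diagP] by simp
    also have "\<dots> = vec ?n (\<lambda>i. ?P $$ (i, i) * vec_index (?D *\<^sub>v v) i)"
      by (rule mat_diag_mult_vec[OF Dv])
    finally have "scalar_prod (?Q *\<^sub>v v) w
        = (\<Sum>i\<in>{0..<?n}. ?P $$ (i, i) * \<kappa> (node d i) t * (vec_index (?D *\<^sub>v v) i)\<^sup>2)"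
      unfolding w_eq scalar_prod_def
      by (simp del: sum.op_ivl_Suc add: power2_eq_square mult_ac cong: sum.cong_simp)
    also have "\<dots> \<ge> 0"
      using sym_pos_def_diag_pos[OF spd] \<kappa> is_fsbp_node_in[OF op]
      by (intro sum_nonneg mult_nonneg_nonneg) (auto simp: less_imp_le)
    finally show ?thesis using sbp_rule[OF Q sbp N v w] by simp
  qed
  have penalty: "scalar_prod v s
      = - vec_index v 0 * (a * vec_index v 0 - vec_index w 0 - gL t)
        - vec_index v (Nn d) * (vec_index w (Nn d) - gR t)"
  proof -
    let ?s = "\<lambda>i. if i = 0 then - (a * vec_index v 0 - vec_index w 0 - gL t)
      else if i = Nn d then - (vec_index w (Nn d) - gR t) else 0"
    have "s = vec ?n ?s"
      by (rule eq_vecI) (auto simp: s_def sat_vec_def Let_def w_def)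
    then have "scalar_prod v s = (\<Sum>i\<in>{0..Nn d}. vec_index v i * ?s i)"
      by (simp del: sum.op_ivl_Suc
        add: scalar_prod_def atLeastLessThanSuc_atLeastAtMost cong: sum.cong_simp)
    also have "\<dots> = (\<Sum>i\<in>{0, Nn d}. vec_index v i * ?s i)"
      by (rule sum.mono_neutral_right) auto
    finally show ?thesis using N by (simp add: algebra_simps)
  qed
  have "2 * scalar_prod v (?P *\<^sub>v ut)
      = 2 * scalar_prod v (?Q *\<^sub>v w) + 2 * scalar_prod v s - a * (2 * scalar_prod v (?Q *\<^sub>v v))"
    using rate by simp
  also have "\<dots> \<le> 2 * (vec_index v (Nn d) * vec_index w (Nn d) - vec_index v 0 * vec_index w 0)
      + 2 * scalar_prod v s - a * (2 * scalar_prod v (?Q *\<^sub>v v))"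
    using diffusion by simp
  \<comment> \<open>The flux products at both ends cancel. On the left the penalty contributes -2a
    times the squared component and advection returns a times it; on the right the loss is that of
    advective outflow.\<close>
  also have "\<dots> = (2 * vec_index v 0 * gL t - a * (vec_index v 0)\<^sup>2)
      + (2 * vec_index v (Nn d) * gR t - a * (vec_index v (Nn d))\<^sup>2)"
    unfolding advection penalty by (simp add: algebra_simps power2_eq_square)
  also have "\<dots> \<le> (gL t)\<^sup>2 / a + (gR t)\<^sup>2 / a"
    by (intro add_mono young_boundary a)
  finally show ?thesis by (simp add: add_divide_distrib)
qed

section \<open>Integration of the energy rate in time\<close>

text \<open>Writes the energy as a finite sum of real functions, to which the componentwise
  derivatives of the scheme apply.\<close>

lemma diagonal_mat_bilinear_form:
  fixes A :: "real mat"
  assumes "A \<in> carrier_mat n n" and "diagonal_mat A" and "w \<in> carrier_vec n"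
  shows "scalar_prod v (A *\<^sub>v w) = (\<Sum>i<n. A $$ (i, i) * vec_index v i * vec_index w i)"
proof -
  have "A *\<^sub>v w = vec n (\<lambda>i. A $$ (i, i) * vec_index w i)"
    using diagonal_mat_eq_mat_diag[OF assms(1,2)] mat_diag_mult_vec[OF assms(3)] by metis
  then show ?thesis
    by (simp add: scalar_prod_def lessThan_atLeast0 mult_ac cong: sum.cong_simp)
qed

text \<open>The rate is at most the constant (GL + GR)/a on the time interval, so the energy minus
  this constant times time does not increase. \<open>GL\<close> and \<open>GR\<close> are arbitrary
  bounds, which covers both zero data and suprema of the data.\<close>

lemma energy_estimate:
  assumes fsbp: "diagonal_norm_fsbp xL xR F d" and "xL < xR" and a: "a > 0"
    and \<kappa>: "\<forall>x\<in>{xL..xR}. \<forall>t\<ge>0. \<kappa> x t > 0"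
    and sol: "scheme_solution a \<kappa> (- 1) 1 gL gR d f u"
    and t: "t \<ge> 0"
    and GL: "\<And>\<tau>. \<tau> \<in> {0..t} \<Longrightarrow> (gL \<tau>)\<^sup>2 \<le> GL" and GR: "\<And>\<tau>. \<tau> \<in> {0..t} \<Longrightarrow> (gR \<tau>)\<^sup>2 \<le> GR"
  shows "(norm_h d (u t))\<^sup>2 \<le> (norm_h d f)\<^sup>2 + t / a * (GL + GR)"
proof -
  let ?n = "Nn d + 1" and ?P = "Pmat d"
  have spd: "sym_pos_def ?n ?P" and diagP: "diagonal_mat ?P"
    using fsbp by (auto simp: diagonal_norm_fsbp_def is_fsbp_def)
  have P: "?P \<in> carrier_mat ?n ?n" using spd by (simp add: sym_pos_def_def)
  have u: "u s \<in> carrier_vec ?n" if "s \<ge> 0" for s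
    using sol that by (simp add: scheme_solution_def)
  have cont: "continuous_on {0..} (\<lambda>s. vec_index (u s) i)" if "i \<le> Nn d" for i
    using sol that by (simp add: scheme_solution_def)
  define E where "E s = (\<Sum>i<?n. ?P $$ (i, i) * (vec_index (u s) i)\<^sup>2)" for s
  have E: "(norm_h d (u s))\<^sup>2 = E s" if "s \<ge> 0" for s
  proof -
    have "E s \<ge> 0" unfolding E_def
      using sym_pos_def_diag_pos[OF spd] by (intro sum_nonneg) (simp add: less_imp_le)
    moreover have "scalar_prod (u s) (?P *\<^sub>v u s) = E s"
      using diagonal_mat_bilinear_form[OF P diagP u[OF that]]
      by (simp add: E_def power2_eq_square mult.assoc)
    ultimately show ?thesis by (simp add: norm_h_def)
  qed
  define c where "c = (GL + GR) / a"
  have "E t - c * t \<le> E 0 - c * 0"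
  \<comment> \<open>The scheme gives a derivative only at positive times; at time 0 continuity must
    do, hence the monotonicity rule for open intervals.\<close>
  proof (rule DERIV_nonpos_imp_decreasing_open[OF t])
    fix s assume s: "0 < s" "s < t"
    then obtain ut where ut: "ut \<in> carrier_vec ?n"
      and der: "\<And>i. i \<le> Nn d \<Longrightarrow>
        ((\<lambda>r. vec_index (u r) i) has_real_derivative vec_index ut i) (at s)"
      and eq: "ut + a \<cdot>\<^sub>v (Dmat d *\<^sub>v u s)
          = Dmat d *\<^sub>v (Kmat \<kappa> d s *\<^sub>v (Dmat d *\<^sub>v u s))
            + Pinv d *\<^sub>v sat_vec a \<kappa> (- 1) 1 gL gR d s (u s)"
      using sol by (auto simp: scheme_solution_def)
    have "(E has_real_derivative
        (\<Sum>i<?n. ?P $$ (i, i) * (2 * vec_index (u s) i * vec_index ut i))) (at s)"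
      unfolding E_def by (auto intro!: derivative_eq_intros der sum.cong)
    also have "(\<Sum>i<?n. ?P $$ (i, i) * (2 * vec_index (u s) i * vec_index ut i))
        = 2 * scalar_prod (u s) (?P *\<^sub>v ut)"
      unfolding diagonal_mat_bilinear_form[OF P diagP ut] sum_distrib_left
      by (simp add: mult_ac)
    finally have "((\<lambda>s. E s - c * s) has_real_derivative
        2 * scalar_prod (u s) (?P *\<^sub>v ut) - c) (at s)"
      by (auto intro!: derivative_eq_intros)
    moreover have "2 * scalar_prod (u s) (?P *\<^sub>v ut) \<le> ((gL s)\<^sup>2 + (gR s)\<^sup>2) / a"
      using s \<kappa> by (intro energy_rate_le[OF fsbp \<open>xL < xR\<close> a _ u ut eq]) (auto simp: less_imp_le)
    moreover have "\<dots> \<le> c"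
      unfolding c_def using s a GL[of s] GR[of s] by (intro divide_right_mono) auto
    ultimately show "\<exists>y. ((\<lambda>s. E s - c * s) has_real_derivative y) (at s) \<and> y \<le> 0"
      by (intro exI[of _ "2 * scalar_prod (u s) (?P *\<^sub>v ut) - c"]) auto
  next
    have "continuous_on {0..t} (\<lambda>s. vec_index (u s) i)" if "i < ?n" for i
      using that by (intro continuous_on_subset[OF cont]) auto
    then show "continuous_on {0..t} (\<lambda>s. E s - c * s)"
      unfolding E_def by (intro continuous_intros) auto
  qed
  moreover have "u 0 = f" using sol by (simp add: scheme_solution_def)
  ultimately show ?thesis
    using E[OF t] E[of 0] by (simp add: c_def mult.commute)
qed

text \<open>A real supremum dominates only when the set is bounded above; here compactness of the
  time interval provides this.\<close>

lemma power2_le_SUP: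
  fixes g :: "real \<Rightarrow> real"
  assumes "continuous_on {0..} g" and "\<tau> \<in> {0..t}"
  shows "(g \<tau>)\<^sup>2 \<le> (SUP \<tau>\<in>{0..t}. \<bar>g \<tau>\<bar>\<^sup>2)"
proof -
  have "continuous_on {0..t} (\<lambda>\<tau>. \<bar>g \<tau>\<bar>\<^sup>2)"
    by (intro continuous_intros continuous_on_subset[OF assms(1)]) auto
  then have "bdd_above ((\<lambda>\<tau>. \<bar>g \<tau>\<bar>\<^sup>2) ` {0..t})"
    by (intro bounded_imp_bdd_above compact_imp_bounded compact_continuous_image) auto
  from cSUP_upper[OF assms(2) this] show ?thesis by simp
qed

section \<open>Stability and strong stability\<close>

theorem theorem3p2:
  fixes xL xR a :: real and \<kappa> :: "real \<Rightarrow> real \<Rightarrow> real"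
    and F :: "(real \<Rightarrow> real) set" and H :: "real set" and d :: "real \<Rightarrow> fsbp"
  assumes "xL < xR" and "a > 0"
    and "smooth_on ({xL..xR} \<times> {0..}) (\<lambda>(x, t). \<kappa> x t)"
    and "\<forall>x\<in>{xL..xR}. \<forall>t\<ge>0. \<kappa> x t > 0"
    and "C1_function_space xL xR F"
    and "fsbp_family xL xR F H d"
  shows "strongly_stable a \<kappa> (- 1) 1 H d"
proof -
  have fsbp: "diagonal_norm_fsbp xL xR F (d h)" if "h \<in> H" for h
    using assms(6) that by (simp add: fsbp_family_def)
  \<comment> \<open>Needed to compare norms through their squares: \<open>sqrt\<close> of a negative
    number is negative, so the sign comes from positive definiteness.\<close>
  have norm_nonneg: "norm_h (d h) v \<ge> 0" if "h \<in> H" "v \<in> carrier_vec (Nn (d h) + 1)" for h v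
  proof -
    have "sym_pos_def (Nn (d h) + 1) (Pmat (d h))"
      using fsbp[OF that(1)] by (simp add: diagonal_norm_fsbp_def is_fsbp_def)
    from sym_pos_def_form_nonneg[OF this that(2)]
    show ?thesis by (simp add: norm_h_def)
  qed
  have stable: "stable a \<kappa> (- 1) 1 H d"
    unfolding stable_def
  \<comment> \<open>Zero data make the energy nonincreasing, hence C = 1 and \<alpha> = 0. The bound
    is uniform over \<open>H\<close>, so 1 serves as threshold.\<close>
  proof (rule exI[of _ 1], rule exI[of _ 0], rule exI[of _ 1], intro conjI ballI allI impI)
    fix h f u and t :: real
    assume "h \<in> H" and f: "f \<in> carrier_vec (Nn (d h) + 1)" and "t \<ge> 0"
      and "scheme_solution a \<kappa> (- 1) 1 (\<lambda>_. 0) (\<lambda>_. 0) (d h) f u"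
    then have "(norm_h (d h) (u t))\<^sup>2 \<le> (norm_h (d h) f)\<^sup>2 + t / a * (0 + 0)"
      by (intro energy_estimate[OF fsbp assms(1,2,4)]) simp_all
    then have "(norm_h (d h) (u t))\<^sup>2 \<le> (norm_h (d h) f)\<^sup>2" by simp
    then have "norm_h (d h) (u t) \<le> norm_h (d h) f"
      using norm_nonneg[OF \<open>h \<in> H\<close> f] by (rule power2_le_imp_le)
    then show "norm_h (d h) (u t) \<le> 1 * exp (0 * t) * norm_h (d h) f" by simp
  qed simp
  show ?thesis
    unfolding strongly_stable_def
  \<comment> \<open>The estimate has coefficient 1 on the initial energy and t/a on the data;
    \<open>1 + t / a\<close> dominates both.\<close>
  proof (rule conjI[OF stable], rule exI[of _ "\<lambda>t. 1 + t / a"], rule exI[of _ 1],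
      intro conjI ballI allI impI)
    fix T :: real
    show "\<exists>M. \<forall>t\<in>{0..T}. \<bar>1 + t / a\<bar> \<le> M"
    proof (intro exI ballI)
      fix t assume t: "t \<in> {0..T}"
      then have "0 \<le> t / a" "t / a \<le> T / a"
        using assms(2) by (simp_all add: divide_right_mono)
      then show "\<bar>1 + t / a\<bar> \<le> 1 + T / a" by linarith
    qed
  next
    fix h f gL gR u and t :: real
    assume "h \<in> H" and gL: "continuous_on {0..} gL" and gR: "continuous_on {0..} gR"
      and t: "t \<ge> 0" and sol: "scheme_solution a \<kappa> (- 1) 1 gL gR (d h) f u"
    let ?L = "SUP \<tau>\<in>{0..t}. \<bar>gL \<tau>\<bar>\<^sup>2" and ?R = "SUP \<tau>\<in>{0..t}. \<bar>gR \<tau>\<bar>\<^sup>2"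
    have "0 \<in> {0..t}" using t by simp
    then have "?L \<ge> 0" "?R \<ge> 0"
      using order_trans[OF zero_le_power2 power2_le_SUP[OF gL]]
        order_trans[OF zero_le_power2 power2_le_SUP[OF gR]] by blast+
    \<comment> \<open>This is exactly the gap between the energy estimate and the required
      product.\<close>
    then have "0 \<le> t / a * (norm_h (d h) f)\<^sup>2 + (?L + ?R)"
      using t assms(2) by (intro add_nonneg_nonneg mult_nonneg_nonneg) simp_all
    moreover have "(norm_h (d h) (u t))\<^sup>2 \<le> (norm_h (d h) f)\<^sup>2 + t / a * (?L + ?R)"
      by (rule energy_estimate[OF fsbp[OF \<open>h \<in> H\<close>] assms(1,2,4) sol t
          power2_le_SUP[OF gL] power2_le_SUP[OF gR]])
    ultimately have "(norm_h (d h) (u t))\<^sup>2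
        \<le> (norm_h (d h) f)\<^sup>2 + t / a * (?L + ?R)
          + (t / a * (norm_h (d h) f)\<^sup>2 + (?L + ?R))" by linarith
    also have "\<dots> = (1 + t / a) * ((norm_h (d h) f)\<^sup>2 + ?L + ?R)"
      by (simp only: distrib_left distrib_right mult_1 add_ac)
    finally show "(norm_h (d h) (u t))\<^sup>2 \<le> (1 + t / a) * ((norm_h (d h) f)\<^sup>2 + ?L + ?R)" .
  qed simp
qed

end
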